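(* Let $(X,p)$ be a partial pseudo-metric space, and write $w_p(x)=p(x,x)$. Then the map $d_{p,2}:X\times X\to\mathbb{R}_+$ defined by $$d_{p,2}(x,y)=\sqrt{p(x,y)^2-w_p(x)\,w_p(y)}$$ is a pseudo-metric on $X$.
   Context: A partial pseudo-metric on a set $X$ is a map $p:X\times X\to\mathbb{R}$ such that, for all $x,y,z\in X$: $p(x,y)=p(y,x)$; $p(x,y)+p(z,z)\leqslant p(x,z)+p(z,y)$; and $0\leqslant p(x,x)\leqslant p(x,y)$. A pseudo-metric is a map $d:X\times X\to\mathbb{R}_+$ with $d(x,x)=0$, $d(x,y)=d(y,x)$ and the triangle inequality. *)

theory Defs
  imports Complex_Main
begin

definition partial_pseudo_metric_on :: "'a set \<Rightarrow> ('a \<Rightarrow> 'a \<Rightarrow> real) \<Rightarrow> bool" where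
  "partial_pseudo_metric_on X p \<longleftrightarrow>
     (\<forall>x\<in>X. \<forall>y\<in>X. p x y = p y x) \<and>
     (\<forall>x\<in>X. \<forall>y\<in>X. \<forall>z\<in>X. p x y + p z z \<le> p x z + p z y) \<and>
     (\<forall>x\<in>X. \<forall>y\<in>X. 0 \<le> p x x \<and> p x x \<le> p x y)"

definition pseudo_metric_on :: "'a set \<Rightarrow> ('a \<Rightarrow> 'a \<Rightarrow> real) \<Rightarrow> bool" where
  "pseudo_metric_on X d \<longleftrightarrow>
     (\<forall>x\<in>X. \<forall>y\<in>X. 0 \<le> d x y) \<and>
     (\<forall>x\<in>X. d x x = 0) \<and>
     (\<forall>x\<in>X. \<forall>y\<in>X. d x y = d y x) \<and>
     (\<forall>x\<in>X. \<forall>y\<in>X. \<forall>z\<in>X. d x y \<le> d x z + d z y)"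

definition weight :: "('a \<Rightarrow> 'a \<Rightarrow> real) \<Rightarrow> 'a \<Rightarrow> real" where
  "weight p x = p x x"

(* The library's sqrt is an odd function, negative on negative reals.  Hence the
   nonnegativity of dist2 p on X, required by pseudo_metric_on, holds exactly when
   the radicand is nonnegative on X, i.e. when dist2 p is a genuine square root there. *)
definition dist2 :: "('a \<Rightarrow> 'a \<Rightarrow> real) \<Rightarrow> 'a \<Rightarrow> 'a \<Rightarrow> real" where
  "dist2 p x y = sqrt ((p x y)\<^sup>2 - weight p x * weight p y)"

end

theory Submission imports Defs begin

text \<open>
  Write \<open>u, v, w\<close> for the weights of \<open>x, y, z\<close> and \<open>a = p x z\<close>, \<open>b = p z y\<close>. As \<open>p x y\<close> is at
  most \<open>a + b - w\<close>, squaring reduces the triangle inequality to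
  \<open>2 (a - w) (b - w) - (u - w) (v - w) \<le> 2 sqrt (a^2 - u w) sqrt (b^2 - w v)\<close>.
  The square roots are at least \<open>a - min u w\<close> and \<open>b - min w v\<close>, and with these lower bounds
  the inequality is elementary in each ordering of \<open>u, v, w\<close>.
\<close>

lemma diff_min_le_sqrt:
  fixes a u w :: real
  assumes "0 \<le> u" "0 \<le> w" "u \<le> a" "w \<le> a"
  shows "a - min u w \<le> sqrt (a\<^sup>2 - u * w)"
proof (rule real_le_rsqrt)
  \<comment> \<open>Since \<open>u * w = min u w * max u w\<close>, this product is exactly
    \<open>(a\<^sup>2 - u * w) - (a - min u w)\<^sup>2\<close>.\<close>
  have "0 \<le> min u w * (2 * a - max u w - min u w)"
    using assms by (intro mult_nonneg_nonneg) auto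
  then show "(a - min u w)\<^sup>2 \<le> a\<^sup>2 - u * w"
    by (auto simp: min_def max_def power2_eq_square algebra_simps split: if_splits)
qed

text \<open>Once the order of \<open>u, v, w\<close> resolves the minima, right side minus left side
  is a sum of nonnegative products.\<close>

lemma diff_min_mult_ge:
  fixes a b u v w :: real
  assumes "u \<le> a" "w \<le> a" "v \<le> b" "w \<le> b"
  shows "2 * ((a - w) * (b - w)) - (u - w) * (v - w) \<le> 2 * ((a - min u w) * (b - min w v))"
proof -
  consider "u \<le> w" "v \<le> w" | "u \<le> w" "w \<le> v" | "w \<le> u" "v \<le> w" | "w \<le> u" "w \<le> v"
    by linarith
  then show ?thesis
  proof cases
    case 1
    have "0 \<le> (w - u) * (b - w)" "0 \<le> (a - w) * (w - v)" "0 \<le> (w - u) * (w - v)"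
      using 1 assms by simp_all
    with 1 show ?thesis by (simp add: min_absorb1 min_absorb2 algebra_simps)
  next
    case 2
    \<comment> \<open>The sides differ by \<open>(w - u) * ((b - v) + (b - w))\<close>; the next
      case is its mirror image.\<close>
    have "0 \<le> (w - u) * (b - v)" "0 \<le> (w - u) * (b - w)"
      using 2 assms by simp_all
    with 2 show ?thesis by (simp add: min_absorb1 min_absorb2 algebra_simps)
  next
    case 3
    have "0 \<le> (a - u) * (w - v)" "0 \<le> (a - w) * (w - v)"
      using 3 assms by simp_all
    with 3 show ?thesis by (simp add: min_absorb1 min_absorb2 algebra_simps)
  next
    case 4
    \<comment> \<open>Both minima equal \<open>w\<close>, so the doubled products cancel and only
      this term remains.\<close>
    have "0 \<le> (u - w) * (v - w)"
      using 4 by simp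
    with 4 show ?thesis by (simp add: min_absorb1 min_absorb2 algebra_simps)
  qed
qed

lemma sqrt_triangle:
  fixes a b c u v w :: real
  assumes nn: "0 \<le> u" "0 \<le> v" "0 \<le> w" "0 \<le> c"
    and le: "u \<le> a" "w \<le> a" "v \<le> b" "w \<le> b" and c: "c \<le> a + b - w"
  shows "sqrt (c\<^sup>2 - u * v) \<le> sqrt (a\<^sup>2 - u * w) + sqrt (b\<^sup>2 - w * v)"
proof (rule real_le_lsqrt)
  let ?r = "sqrt (a\<^sup>2 - u * w)" and ?s = "sqrt (b\<^sup>2 - w * v)"
  have r: "u * w \<le> a\<^sup>2" and s: "w * v \<le> b\<^sup>2"
    using nn le by (auto simp: power2_eq_square intro: mult_mono)
  then show "0 \<le> ?r + ?s" by simp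
  have "c\<^sup>2 - u * v \<le> (a + b - w)\<^sup>2 - u * v"
    using nn c by (simp add: power_mono)
  also have "\<dots> = (a\<^sup>2 - u * w) + (b\<^sup>2 - w * v) + (2 * ((a - w) * (b - w)) - (u - w) * (v - w))"
    by (simp add: power2_eq_square algebra_simps)
  also have "\<dots> \<le> (a\<^sup>2 - u * w) + (b\<^sup>2 - w * v) + 2 * ((a - min u w) * (b - min w v))"
    using diff_min_mult_ge[OF le] by simp
  \<comment> \<open>Both lower bounds for the roots are nonnegative, so they may be
    multiplied.\<close>
  also have "\<dots> \<le> (a\<^sup>2 - u * w) + (b\<^sup>2 - w * v) + 2 * (?r * ?s)"
    using nn le r s diff_min_le_sqrt[of u w a] diff_min_le_sqrt[of w v b]
    by (intro add_left_mono mult_left_mono mult_mono) auto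
  also have "\<dots> = (?r + ?s)\<^sup>2"
    using r s by (simp add: power2_sum)
  finally show "c\<^sup>2 - u * v \<le> (?r + ?s)\<^sup>2" .
qed

theorem theorem5p2:
  fixes X :: "'a set" and p :: "'a \<Rightarrow> 'a \<Rightarrow> real"
  assumes "partial_pseudo_metric_on X p"
  shows "pseudo_metric_on X (dist2 p)"
proof -
  have sym: "p x y = p y x" and le: "p x x \<le> p x y" if "x \<in> X" "y \<in> X" for x y
    using assms that by (simp_all add: partial_pseudo_metric_on_def)
  have nn: "0 \<le> p x x" if "x \<in> X" for x
    using assms that by (simp add: partial_pseudo_metric_on_def)
  have tri: "p x y \<le> p x z + p z y - p z z" if "x \<in> X" "y \<in> X" "z \<in> X" for x y z
    using assms that unfolding partial_pseudo_metric_on_def le_diff_eq by blast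
  have nonneg: "0 \<le> p x y" if "x \<in> X" "y \<in> X" for x y
    using nn[of x] le[of x y] that by simp
  have le': "p y y \<le> p x y" if "x \<in> X" "y \<in> X" for x y
    using le[of y x] sym[of x y] that by simp
  show ?thesis
    unfolding pseudo_metric_on_def dist2_def weight_def
  proof (intro conjI ballI)
    fix x y assume xy: "x \<in> X" "y \<in> X"
    \<comment> \<open>The radicand is nonnegative because \<open>p x x\<close> and
      \<open>p y y\<close> both lie between 0 and \<open>p x y\<close>.\<close>
    show "0 \<le> sqrt ((p x y)\<^sup>2 - p x x * p y y)"
      using mult_mono[OF le[OF xy] le'[OF xy]] nonneg[OF xy] nn[OF xy(2)]
      by (simp add: power2_eq_square)
    show "sqrt ((p x y)\<^sup>2 - p x x * p y y) = sqrt ((p y x)\<^sup>2 - p y y * p x x)"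
      using sym[OF xy] by (simp add: mult.commute)
    fix z assume z: "z \<in> X"
    show "sqrt ((p x y)\<^sup>2 - p x x * p y y)
        \<le> sqrt ((p x z)\<^sup>2 - p x x * p z z) + sqrt ((p z y)\<^sup>2 - p z z * p y y)"
      by (intro sqrt_triangle nn nonneg le le' tri xy z)
  qed (simp add: power2_eq_square)
qed

end
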